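(* Let $(X,T)$ be a minimal dynamical system. Then $(X,T)$ is either pairwise IP-sensitive or almost pairwise IP$^*$-equicontinuous.
   Context: A dynamical system is a pair $(X,T)$ where $X$ is a compact metric space with metric $d$ and $T\colon X\to X$ is a continuous surjection. $\mathbb{N}$ is the set of positive integers. A subsystem is a non-empty closed $Y\subset X$ with $TY\subset Y$; a system is minimal if it has no proper subsystem. A set $F\subset\mathbb{N}$ is an IP-set if there is a sequence $(p_i)_{i\ge1}$ in $\mathbb{N}$ such that $\sum_{i\in\alpha}p_i\in F$ for every non-empty finite $\alpha\subset\mathbb{N}$; it is an IP$^*$-set if it meets every IP-set. $(X,T)$ is pairwise IP-sensitive if there is $\delta>0$ such that for every non-empty open $U\subset X$ there exist $x_1,x_2\in U$ such that $\{k\in\mathbb{N}: d(T^kx_1,T^kx_2)>\delta\}$ is an IP-set. A point $x\in X$ is pairwise IP$^*$-equicontinuous if for every $\varepsilon>0$ there is a neighbourhood $U$ of $x$ such that for all $y,z\in U$, $\{k\in\mathbb{N}:d(T^ky,T^kz)<\varepsilon\}$ is an IP$^*$-set. $(X,T)$ is almost pairwise IP$^*$-equicontinuous if the set of pairwise IP$^*$-equicontinuous points is residual in $X$ (contains a dense $G_\delta$ set). *)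

theory Defs
  imports "HOL-Analysis.Analysis"
begin

text \<open>
  The phase space is a whole type of class \<open>metric_space\<close> (hence non-empty); its compactness is part
  of \<open>dynamical_system\<close>.  The positive integers are \<open>{1..} :: nat set\<close>.
\<close>

definition dynamical_system :: "('a::metric_space \<Rightarrow> 'a) \<Rightarrow> bool" where
  "dynamical_system T \<longleftrightarrow> compact (UNIV :: 'a set) \<and> continuous_on UNIV T \<and> surj T"

definition subsystem :: "('a::metric_space \<Rightarrow> 'a) \<Rightarrow> 'a set \<Rightarrow> bool" where
  "subsystem T Y \<longleftrightarrow> Y \<noteq> {} \<and> closed Y \<and> T ` Y \<subseteq> Y"

definition minimal_system :: "('a::metric_space \<Rightarrow> 'a) \<Rightarrow> bool" where
  "minimal_system T \<longleftrightarrow> dynamical_system T \<and> \<not> (\<exists>Y. subsystem T Y \<and> Y \<noteq> UNIV)"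

definition IP_set :: "nat set \<Rightarrow> bool" where
  "IP_set F \<longleftrightarrow> F \<subseteq> {1..} \<and>
     (\<exists>p :: nat \<Rightarrow> nat. (\<forall>i\<ge>1. p i \<ge> 1) \<and>
        (\<forall>\<alpha>. finite \<alpha> \<and> \<alpha> \<noteq> {} \<and> \<alpha> \<subseteq> {1..} \<longrightarrow> (\<Sum>i\<in>\<alpha>. p i) \<in> F))"

definition IP_star_set :: "nat set \<Rightarrow> bool" where
  "IP_star_set F \<longleftrightarrow> F \<subseteq> {1..} \<and> (\<forall>G. IP_set G \<longrightarrow> F \<inter> G \<noteq> {})"

definition pairwise_IP_sensitive :: "('a::metric_space \<Rightarrow> 'a) \<Rightarrow> bool" where
  "pairwise_IP_sensitive T \<longleftrightarrow>
     (\<exists>\<delta>>0. \<forall>U. open U \<and> U \<noteq> {} \<longrightarrow>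
        (\<exists>x1\<in>U. \<exists>x2\<in>U. IP_set {k \<in> {1..}. dist ((T ^^ k) x1) ((T ^^ k) x2) > \<delta>}))"

definition pairwise_IP_star_equicontinuous_at :: "('a::metric_space \<Rightarrow> 'a) \<Rightarrow> 'a \<Rightarrow> bool" where
  "pairwise_IP_star_equicontinuous_at T x \<longleftrightarrow>
     (\<forall>\<epsilon>>0. \<exists>U. open U \<and> x \<in> U \<and>
        (\<forall>y\<in>U. \<forall>z\<in>U. IP_star_set {k \<in> {1..}. dist ((T ^^ k) y) ((T ^^ k) z) < \<epsilon>}))"

definition residual :: "'a::topological_space set \<Rightarrow> bool" where
  "residual A \<longleftrightarrow> (\<exists>G. gdelta G \<and> closure G = UNIV \<and> G \<subseteq> A)"

definition almost_pairwise_IP_star_equicontinuous :: "('a::metric_space \<Rightarrow> 'a) \<Rightarrow> bool" where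
  "almost_pairwise_IP_star_equicontinuous T \<longleftrightarrow>
     residual {x. pairwise_IP_star_equicontinuous_at T x}"

end

theory Submission
  imports Defs
begin

text \<open>
  If \<open>T\<close> is not sensitive, then for every \<open>\<epsilon>\<close> some non-empty open set \<open>U\<close> consists of points that
  are pairwise \<open>\<epsilon>\<close>-close along an IP*-set of times.  IP*-sets are not translation invariant, so such a
  set cannot be pulled back along the dynamics; but it can be pushed forward by \<open>T ^^ n\<close>, at the cost
  of a modulus of continuity \<open>\<eta>\<close> for \<open>T ^^ n\<close>.  Given a target \<open>W\<close>, minimality bounds the hitting
  times of \<open>W\<close> by some \<open>N\<close>, so \<open>\<eta>\<close> can be chosen before \<open>U\<close>.  As minimal maps are semi-open, the
  image of \<open>U\<close> has interior points in \<open>W\<close>, and the Baire category theorem concludes.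
\<close>

lemma IP_set_mono:
  assumes "IP_set F" "F \<subseteq> G" "G \<subseteq> {1..}"
  shows "IP_set G"
proof -
  obtain p :: "nat \<Rightarrow> nat" where p: "\<forall>i\<ge>1. p i \<ge> 1"
    "\<forall>\<alpha>. finite \<alpha> \<and> \<alpha> \<noteq> {} \<and> \<alpha> \<subseteq> {1..} \<longrightarrow> (\<Sum>i\<in>\<alpha>. p i) \<in> F"
    using assms(1) unfolding IP_set_def by (elim conjE exE) (rule that)
  show ?thesis
    unfolding IP_set_def
  proof (intro conjI exI[of _ p] allI impI)
    show "(\<Sum>i\<in>\<alpha>. p i) \<in> G" if "finite \<alpha> \<and> \<alpha> \<noteq> {} \<and> \<alpha> \<subseteq> {1..}" for \<alpha>
      using p(2)[rule_format, OF that] assms(2) by (rule rev_subsetD)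
  qed (rule assms(3), rule p(1)[rule_format])
qed

lemma IP_star_set_mono:
  assumes "IP_star_set F" "F \<subseteq> G" "G \<subseteq> {1..}"
  shows "IP_star_set G"
  using assms unfolding IP_star_set_def by blast

lemma IP_star_set_of_not_IP_set:
  assumes "\<not> IP_set F" "F \<subseteq> {1..}"
  shows "IP_star_set ({1..} - F)"
  unfolding IP_star_set_def
proof (intro conjI allI impI)
  fix G assume G: "IP_set G"
  then have "\<not> G \<subseteq> F"
    using IP_set_mono assms by blast
  moreover have "G \<subseteq> {1..}"
    using G by (simp add: IP_set_def)
  ultimately show "({1..} - F) \<inter> G \<noteq> {}"
    by blast
qed auto

lemma continuous_on_funpow:
  fixes T :: "'a::topological_space \<Rightarrow> 'a"
  assumes "continuous_on UNIV T"
  shows "continuous_on UNIV (T ^^ n)"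
proof (induction n)
  case (Suc n)
  then show ?case
    using continuous_on_compose[OF Suc] assms continuous_on_subset by (simp add: comp_def) blast
qed simp

lemma minimal_system_hitting_bound:
  fixes T :: "'a::metric_space \<Rightarrow> 'a"
  assumes T: "minimal_system T" and V: "open V" "V \<noteq> {}"
  obtains N where "\<And>x. \<exists>n\<le>N. (T ^^ n) x \<in> V"
proof -
  have cT: "continuous_on UNIV T" and cpt: "compact (UNIV :: 'a set)"
    using T by (auto simp: minimal_system_def dynamical_system_def)
  have op: "open ((T ^^ n) -` V)" for n
    using continuous_on_funpow[OF cT] V(1) by (simp add: continuous_on_open_vimage)
  define Y where "Y = - (\<Union>n. (T ^^ n) -` V)"
  have "closed Y"
    unfolding Y_def using op by (intro closed_Compl open_UN) auto
  moreover have "T ` Y \<subseteq> Y"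
  proof clarify
    fix x assume "x \<in> Y"
    then have "(T ^^ Suc n) x \<notin> V" for n
      by (simp add: Y_def del: funpow.simps)
    then show "T x \<in> Y"
      by (simp add: Y_def funpow_swap1)
  qed
  moreover have "Y \<noteq> UNIV"
  proof -
    obtain v where "v \<in> V" using V(2) by blast
    then have "v \<in> (T ^^ 0) -` V" by simp
    then show ?thesis unfolding Y_def by blast
  qed
  ultimately have "Y = {}"
    using T unfolding minimal_system_def subsystem_def by blast
  then have "UNIV \<subseteq> (\<Union>n. (T ^^ n) -` V)"
    unfolding Y_def by blast
  then obtain C where C: "finite C" "UNIV \<subseteq> (\<Union>n\<in>C. (T ^^ n) -` V)"
    using compactE_image[OF cpt, of UNIV "\<lambda>n. (T ^^ n) -` V"] op by metis
  show ?thesis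
  proof (rule that)
    fix x
    obtain n where "n \<in> C" "(T ^^ n) x \<in> V"
      using C(2) by blast
    then show "\<exists>n\<le>Max C. (T ^^ n) x \<in> V"
      using C(1) Max_ge by blast
  qed
qed

text \<open>
  A closed proper subset \<open>F\<close> with \<open>T ` F = UNIV\<close> would contain arbitrarily long orbit segments
  (follow preimages inside \<open>F\<close>), all missing the open set \<open>- F\<close>.
\<close>

lemma minimal_system_irreducible:
  fixes T :: "'a::metric_space \<Rightarrow> 'a"
  assumes T: "minimal_system T" and F: "closed F" "T ` F = UNIV"
  shows "F = UNIV"
proof (rule ccontr)
  assume "F \<noteq> UNIV"
  then obtain N where N: "\<And>x. \<exists>n\<le>N. (T ^^ n) x \<in> - F"
    using minimal_system_hitting_bound[OF T, of "- F"] F(1) by (metis Compl_empty_eq double_complement open_Compl)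
  have "\<exists>x. \<forall>k\<le>n. (T ^^ k) x \<in> F" for n
  proof (induction n)
    case 0
    then show ?case using F(2) by auto
  next
    case (Suc n)
    then obtain x where x: "\<forall>k\<le>n. (T ^^ k) x \<in> F" by blast
    obtain y where y: "y \<in> F" "x = T y" using F(2) by blast
    have "(T ^^ k) y \<in> F" if "k \<le> Suc n" for k
      using that x y by (cases k) (auto simp: funpow_swap1)
    then show ?case by blast
  qed
  then show False using N by fastforce
qed

lemma minimal_system_semiopen:
  fixes T :: "'a::metric_space \<Rightarrow> 'a"
  assumes T: "minimal_system T" and V: "open V" "V \<noteq> {}"
  shows "interior (T ` V) \<noteq> {}"
proof -
  have cT: "continuous_on UNIV T" and cpt: "compact (UNIV :: 'a set)" and sT: "surj T"
    using T by (auto simp: minimal_system_def dynamical_system_def)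
  have "compact (- V)"
    using compact_Int_closed[OF cpt, of "- V"] V(1) by auto
  then have "closed (T ` (- V))"
    using cT by (meson compact_continuous_image compact_imp_closed continuous_on_subset subset_UNIV)
  moreover have "T ` (- V) \<noteq> UNIV"
    using minimal_system_irreducible[OF T, of "- V"] V by auto
  moreover have "- (T ` (- V)) \<subseteq> T ` V"
    using sT by (metis Compl_subset_Compl_iff double_complement surj_Compl_image_subset)
  ultimately show ?thesis
    using interior_maximal[of "- (T ` (- V))" "T ` V"] by auto
qed

lemma minimal_system_funpow_semiopen:
  fixes T :: "'a::metric_space \<Rightarrow> 'a"
  assumes T: "minimal_system T" and V: "open V" "V \<noteq> {}"
  shows "interior ((T ^^ n) ` V) \<noteq> {}"
proof (induction n)
  case 0
  then show ?case using V by (simp add: interior_open)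
next
  case (Suc n)
  have "T ` interior ((T ^^ n) ` V) \<subseteq> (T ^^ Suc n) ` V"
    using interior_subset[of "(T ^^ n) ` V"] by fastforce
  then show ?case
    using minimal_system_semiopen[OF T open_interior Suc] interior_mono by blast
qed

lemma funpow_equicontinuous_upto:
  fixes T :: "'a::metric_space \<Rightarrow> 'a"
  assumes T: "uniformly_continuous_on UNIV T" and "\<epsilon> > 0"
  shows "\<exists>\<eta>>0. \<forall>n\<le>N. \<forall>x y. dist x y < \<eta> \<longrightarrow> dist ((T ^^ n) x) ((T ^^ n) y) < \<epsilon>"
proof (induction N)
  case 0
  then show ?case using assms(2) by auto
next
  case (Suc N)
  then obtain \<eta> where \<eta>: "\<eta> > 0"
    "\<And>n x y. n \<le> N \<Longrightarrow> dist x y < \<eta> \<Longrightarrow> dist ((T ^^ n) x) ((T ^^ n) y) < \<epsilon>" by blast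
  obtain \<zeta> where \<zeta>: "\<zeta> > 0" "\<And>x y. dist x y < \<zeta> \<Longrightarrow> dist (T x) (T y) < \<eta>"
    using T \<eta>(1) unfolding uniformly_continuous_on_def by (metis UNIV_I)
  have "dist ((T ^^ n) x) ((T ^^ n) y) < \<epsilon>" if "n \<le> Suc N" "dist x y < min \<zeta> \<epsilon>" for n x y
    using that \<eta>(2)[of "n - 1" "T x" "T y"] \<zeta>(2)[of x y] by (cases n) (auto simp: funpow_swap1)
  then show ?case
    using \<zeta>(1) assms(2) by (intro exI[of _ "min \<zeta> \<epsilon>"]) auto
qed

definition IP_star_close_on :: "('a::metric_space \<Rightarrow> 'a) \<Rightarrow> real \<Rightarrow> 'a set \<Rightarrow> bool" where
  "IP_star_close_on T \<epsilon> U \<longleftrightarrow>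
     (\<forall>y\<in>U. \<forall>z\<in>U. IP_star_set {k \<in> {1..}. dist ((T ^^ k) y) ((T ^^ k) z) < \<epsilon>})"

lemma IP_star_close_on_mono:
  assumes "IP_star_close_on T \<delta> U" "\<delta> \<le> \<epsilon>" "V \<subseteq> U"
  shows "IP_star_close_on T \<epsilon> V"
  unfolding IP_star_close_on_def
proof (intro ballI)
  fix y z assume "y \<in> V" "z \<in> V"
  with assms have "IP_star_set {k \<in> {1..}. dist ((T ^^ k) y) ((T ^^ k) z) < \<delta>}"
    by (auto simp: IP_star_close_on_def)
  then show "IP_star_set {k \<in> {1..}. dist ((T ^^ k) y) ((T ^^ k) z) < \<epsilon>}"
    by (rule IP_star_set_mono) (use assms(2) in auto)
qed

lemma IP_star_close_on_funpow_image:
  assumes U: "IP_star_close_on T \<eta> U"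
    and \<eta>: "\<And>x y. dist x y < \<eta> \<Longrightarrow> dist ((T ^^ n) x) ((T ^^ n) y) < \<epsilon>"
  shows "IP_star_close_on T \<epsilon> ((T ^^ n) ` U)"
  unfolding IP_star_close_on_def
proof clarify
  fix y z assume "y \<in> U" "z \<in> U"
  with U have *: "IP_star_set {k \<in> {1..}. dist ((T ^^ k) y) ((T ^^ k) z) < \<eta>}"
    by (auto simp: IP_star_close_on_def)
  have "(T ^^ k) ((T ^^ n) x) = (T ^^ n) ((T ^^ k) x)" for k x
    by (metis add.commute comp_apply funpow_add)
  then show "IP_star_set {k \<in> {1..}. dist ((T ^^ k) ((T ^^ n) y)) ((T ^^ k) ((T ^^ n) z)) < \<epsilon>}"
    by (intro IP_star_set_mono[OF *]) (auto intro: \<eta>)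
qed

lemma not_sensitive_imp_IP_star_close_on:
  fixes T :: "'a::metric_space \<Rightarrow> 'a"
  assumes "\<not> pairwise_IP_sensitive T" "\<epsilon> > 0"
  obtains U where "open U" "U \<noteq> {}" "IP_star_close_on T \<epsilon> U"
proof -
  have "\<epsilon> / 2 > 0" using assms(2) by simp
  then obtain U where U: "open U" "U \<noteq> {}"
    and *: "\<And>y z. y \<in> U \<Longrightarrow> z \<in> U \<Longrightarrow> \<not> IP_set {k \<in> {1..}. dist ((T ^^ k) y) ((T ^^ k) z) > \<epsilon> / 2}"
    using assms(1) unfolding pairwise_IP_sensitive_def by meson
  have "IP_star_set {k \<in> {1..}. dist ((T ^^ k) y) ((T ^^ k) z) < \<epsilon>}" if "y \<in> U" "z \<in> U" for y z
    by (rule IP_star_set_mono[OF IP_star_set_of_not_IP_set[OF *[OF that]]]) (use assms(2) in auto)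
  then show ?thesis
    using that U by (auto simp: IP_star_close_on_def)
qed

lemma minimal_not_sensitive_dense:
  fixes T :: "'a::metric_space \<Rightarrow> 'a"
  assumes T: "minimal_system T" and ns: "\<not> pairwise_IP_sensitive T" and "\<epsilon> > 0"
    and W: "open W" "W \<noteq> {}"
  obtains V where "open V" "V \<noteq> {}" "V \<subseteq> W" "IP_star_close_on T \<epsilon> V"
proof -
  have cT: "continuous_on UNIV T" and cpt: "compact (UNIV :: 'a set)"
    using T by (auto simp: minimal_system_def dynamical_system_def)
  obtain N where N: "\<And>x. \<exists>n\<le>N. (T ^^ n) x \<in> W"
    using minimal_system_hitting_bound[OF T W] by blast
  obtain \<eta> where "\<eta> > 0"
    and \<eta>: "\<And>n x y. n \<le> N \<Longrightarrow> dist x y < \<eta> \<Longrightarrow> dist ((T ^^ n) x) ((T ^^ n) y) < \<epsilon>"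
    using funpow_equicontinuous_upto[OF compact_uniformly_continuous[OF cT cpt] \<open>\<epsilon> > 0\<close>] by metis
  obtain U where U: "open U" "U \<noteq> {}" "IP_star_close_on T \<eta> U"
    using not_sensitive_imp_IP_star_close_on[OF ns \<open>\<eta> > 0\<close>] by blast
  obtain n where n: "n \<le> N" "U \<inter> (T ^^ n) -` W \<noteq> {}"
    using U(2) N by (metis disjoint_iff ex_in_conv vimageI)
  let ?U = "U \<inter> (T ^^ n) -` W"
  let ?V = "interior ((T ^^ n) ` ?U)"
  have "open ?U"
    using U(1) W(1) continuous_on_funpow[OF cT, of n] by (simp add: continuous_on_open_vimage open_Int)
  then have "?V \<noteq> {}"
    using minimal_system_funpow_semiopen[OF T] n(2) by blast
  moreover have sub: "?V \<subseteq> (T ^^ n) ` ?U"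
    by (rule interior_subset)
  then have "?V \<subseteq> W"
    by blast
  moreover have "IP_star_close_on T \<epsilon> ((T ^^ n) ` U)"
    using IP_star_close_on_funpow_image[OF U(3) \<eta>[OF n(1)]] .
  then have "IP_star_close_on T \<epsilon> ?V"
    by (rule IP_star_close_on_mono) (use sub in auto)
  ultimately show ?thesis
    using that by blast
qed

lemma compact_Baire:
  fixes \<G> :: "'a::metric_space set set"
  assumes "compact (UNIV :: 'a set)" "countable \<G>"
    and "\<And>G. G \<in> \<G> \<Longrightarrow> open G \<and> closure G = UNIV"
  shows "closure (\<Inter>\<G>) = UNIV"
proof -
  have "Met_TC.mcomplete TYPE('a)"
    using assms(1) by (intro Met_TC.compact_space_imp_mcomplete) (simp add: compact_space_def)
  then have "Met_TC.mtopology closure_of \<Inter>\<G> = UNIV"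
    using assms(2,3) by (intro Met_TC.metric_Baire_category) auto
  then show ?thesis by simp
qed

lemma minimal_not_sensitive_imp_almost_equicontinuous:
  fixes T :: "'a::metric_space \<Rightarrow> 'a"
  assumes T: "minimal_system T" and ns: "\<not> pairwise_IP_sensitive T"
  shows "almost_pairwise_IP_star_equicontinuous T"
proof -
  have cpt: "compact (UNIV :: 'a set)"
    using T by (auto simp: minimal_system_def dynamical_system_def)
  define G where "G n = \<Union>{U. open U \<and> IP_star_close_on T (inverse (real (Suc n))) U}" for n
  have opG: "open (G n)" for n
    unfolding G_def by auto
  have "closure (G n) = UNIV" for n
  proof -
    have "W \<inter> G n \<noteq> {}" if W: "open W" "W \<noteq> {}" for W
    proof -
      obtain V where "open V" "V \<noteq> {}" "V \<subseteq> W" "IP_star_close_on T (inverse (real (Suc n))) V"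
        using minimal_not_sensitive_dense[OF T ns _ W] by (metis inverse_Suc)
      then show ?thesis unfolding G_def by blast
    qed
    then show ?thesis
      using closure_subset[of "G n"] open_Compl[OF closed_closure, of "G n"] by blast
  qed
  then have dense: "closure (\<Inter>(range G)) = UNIV"
    using opG by (intro compact_Baire[OF cpt]) auto
  have "pairwise_IP_star_equicontinuous_at T x" if x: "x \<in> \<Inter>(range G)" for x
    unfolding pairwise_IP_star_equicontinuous_at_def IP_star_close_on_def[symmetric]
  proof (intro allI impI)
    fix \<epsilon> :: real assume "\<epsilon> > 0"
    then obtain n where n: "inverse (real (Suc n)) < \<epsilon>"
      using reals_Archimedean by blast
    obtain U where "open U" "x \<in> U" "IP_star_close_on T (inverse (real (Suc n))) U"
      using x unfolding G_def by blast
    then show "\<exists>U. open U \<and> x \<in> U \<and> IP_star_close_on T \<epsilon> U"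
      using IP_star_close_on_mono n by (metis less_imp_le subset_refl)
  qed
  moreover have "gdelta (\<Inter>(range G))"
    using opG by (intro gdelta.intros) auto
  ultimately show ?thesis
    unfolding almost_pairwise_IP_star_equicontinuous_def residual_def using dense by blast
qed

lemma sensitive_imp_not_equicontinuous_at:
  fixes T :: "'a::metric_space \<Rightarrow> 'a"
  assumes "pairwise_IP_sensitive T"
  shows "\<not> pairwise_IP_star_equicontinuous_at T x"
proof
  assume eq: "pairwise_IP_star_equicontinuous_at T x"
  obtain \<delta> where "\<delta> > 0" and \<delta>: "\<And>U. open U \<Longrightarrow> U \<noteq> {} \<Longrightarrow>
      \<exists>y\<in>U. \<exists>z\<in>U. IP_set {k \<in> {1..}. dist ((T ^^ k) y) ((T ^^ k) z) > \<delta>}"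
    using assms unfolding pairwise_IP_sensitive_def by blast
  have "\<exists>U. open U \<and> x \<in> U \<and> IP_star_close_on T \<delta> U"
    using eq \<open>\<delta> > 0\<close> by (simp add: pairwise_IP_star_equicontinuous_at_def IP_star_close_on_def)
  then obtain U where U: "open U" "x \<in> U" "IP_star_close_on T \<delta> U"
    by blast
  obtain y z where "y \<in> U" "z \<in> U" "IP_set {k \<in> {1..}. dist ((T ^^ k) y) ((T ^^ k) z) > \<delta>}"
    using \<delta>[OF U(1)] U(2) by blast
  moreover have "IP_star_set {k \<in> {1..}. dist ((T ^^ k) y) ((T ^^ k) z) < \<delta>}"
    using U(3) \<open>y \<in> U\<close> \<open>z \<in> U\<close> by (simp add: IP_star_close_on_def)
  ultimately show False
    unfolding IP_star_set_def by fastforce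
qed

theorem theorem3p16:
  fixes T :: "'a::metric_space \<Rightarrow> 'a"
  assumes "minimal_system T"
  shows "(pairwise_IP_sensitive T \<or> almost_pairwise_IP_star_equicontinuous T) \<and>
    \<not> (pairwise_IP_sensitive T \<and> almost_pairwise_IP_star_equicontinuous T)"
proof -
  have "\<exists>x. pairwise_IP_star_equicontinuous_at T x"
    if "almost_pairwise_IP_star_equicontinuous T"
    using that unfolding almost_pairwise_IP_star_equicontinuous_def residual_def
    by (metis UNIV_not_empty closure_empty mem_Collect_eq subset_empty ex_in_conv)
  then show ?thesis
    using minimal_not_sensitive_imp_almost_equicontinuous[OF assms]
      sensitive_imp_not_equicontinuous_at by blast
qed

end
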